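(* For any triangle-free graph $G$ with $\frac38\leq\alpha(G)\leq\frac12$ we have $$\beta(G)\leq\frac12\,\alpha(G)\left(\frac12-\alpha(G)\right).$$
   Context: All graphs are finite and simple. For a graph $G$ with $n\geq 1$ vertices, $\alpha(G)=\max\{|A|/n : A\subseteq V(G) \text{ an independent set}\}$ is the relative independence number. A half in $G$ is a function $\mu: V(G)\to[0,1]$ such that $\sum_{v\in V(G)}\mu(v)=n/2$. Put $\beta(G,\mu)=\frac1{n^2}\sum_{\{u,v\}\in E(G)}\mu(u)\mu(v)$ (each edge is counted once) and $\beta(G)=\min\{\beta(G,\mu): \mu \text{ is a half in } G\}$. *)

theory Defs
  imports "HOL-Analysis.Analysis" "HOL-Library.Ramsey"
begin

text \<open>
  A graph is a vertex set \<open>V\<close> together with a set \<open>E\<close> of two-element subsets of \<open>V\<close>. Cliques and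
  independent sets are \<^const>\<open>clique\<close> and \<^const>\<open>indep\<close>.
\<close>

definition finite_simple_graph :: "'a set \<Rightarrow> 'a set set \<Rightarrow> bool" where
  "finite_simple_graph V E \<longleftrightarrow> finite V \<and> E \<subseteq> [V]\<^bsup>2\<^esup>"

definition triangle_free :: "'a set \<Rightarrow> 'a set set \<Rightarrow> bool" where
  "triangle_free V E \<longleftrightarrow> \<not> (\<exists>T\<subseteq>V. card T = 3 \<and> clique T E)"

definition rel_indep_number :: "'a set \<Rightarrow> 'a set set \<Rightarrow> real" where
  "rel_indep_number V E = Max {real (card A) / real (card V) | A. A \<subseteq> V \<and> indep A E}"

text \<open>A half is a function on \<open>V\<close>; the values of \<open>\<mu>\<close> outside \<open>V\<close> are irrelevant.\<close>

definition is_half :: "'a set \<Rightarrow> ('a \<Rightarrow> real) \<Rightarrow> bool" where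
  "is_half V \<mu> \<longleftrightarrow> (\<forall>v\<in>V. 0 \<le> \<mu> v \<and> \<mu> v \<le> 1) \<and> (\<Sum>v\<in>V. \<mu> v) = real (card V) / 2"

text \<open>An edge \<open>e = {u, v}\<close> contributes \<open>(\<Prod>w\<in>e. \<mu> w) = \<mu> u * \<mu> v\<close>, once.\<close>

definition half_density :: "'a set \<Rightarrow> 'a set set \<Rightarrow> ('a \<Rightarrow> real) \<Rightarrow> real" where
  "half_density V E \<mu> = (\<Sum>e\<in>E. \<Prod>w\<in>e. \<mu> w) / (real (card V))\<^sup>2"

text \<open>
  The minimum is taken over an infinite set of reals, hence \<^const>\<open>Least\<close> rather than \<^const>\<open>Min\<close>.
  It exists by compactness; see \<open>min_half_density_attained\<close> below.
\<close>

definition min_half_density :: "'a set \<Rightarrow> 'a set set \<Rightarrow> real" where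
  "min_half_density V E = (LEAST b. \<exists>\<mu>. is_half V \<mu> \<and> b = half_density V E \<mu>)"

lemma ex_minimal_half:
  assumes "finite_simple_graph V E"
  shows "\<exists>\<mu>. is_half V \<mu> \<and> (\<forall>\<nu>. is_half V \<nu> \<longrightarrow> half_density V E \<mu> \<le> half_density V E \<nu>)"
proof -
  define B :: "('a \<Rightarrow> real) set" where "B = (\<Pi>\<^sub>E v\<in>UNIV. {0..1})"
  define H where "H = B \<inter> {\<mu>. (\<Sum>v\<in>V. \<mu> v) = real (card V) / 2}"
  have "compactin (product_topology (\<lambda>_. euclidean) UNIV) B"
    unfolding B_def compactin_PiE by simp
  then have "compact B"
    by (simp add: euclidean_product_topology)
  moreover have "closed {\<mu>. (\<Sum>v\<in>V. \<mu> v) = real (card V) / 2}"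
    by (intro closed_Collect_eq continuous_intros continuous_on_product_coordinates)
  ultimately have "compact H"
    unfolding H_def by blast
  moreover have "(\<lambda>_. 1/2) \<in> H"
    by (simp add: H_def B_def PiE_iff)
  moreover have "continuous_on H (half_density V E)"
    unfolding half_density_def divide_inverse
    by (intro continuous_intros continuous_on_subset[OF continuous_on_product_coordinates]) auto
  ultimately obtain \<mu> where \<mu>: "\<mu> \<in> H" "\<And>\<nu>. \<nu> \<in> H \<Longrightarrow> half_density V E \<mu> \<le> half_density V E \<nu>"
    using continuous_attains_inf[of H "half_density V E"] by blast
  have "half_density V E \<mu> \<le> half_density V E \<nu>" if \<nu>: "is_half V \<nu>" for \<nu>
  proof -
    define \<nu>' where "\<nu>' = (\<lambda>v. if v \<in> V then \<nu> v else 0)"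
    have "\<nu>' \<in> H"
      using \<nu> by (auto simp: H_def B_def PiE_iff is_half_def \<nu>'_def)
    moreover have "half_density V E \<nu>' = half_density V E \<nu>"
    proof -
      have "(\<Prod>w\<in>e. \<nu>' w) = (\<Prod>w\<in>e. \<nu> w)" if "e \<in> E" for e
        using that assms
        by (intro prod.cong) (auto simp: \<nu>'_def finite_simple_graph_def nsets_def)
      then show ?thesis by (simp add: half_density_def)
    qed
    ultimately show ?thesis using \<mu>(2) by metis
  qed
  moreover have "is_half V \<mu>"
    using \<mu>(1) by (auto simp: H_def B_def is_half_def PiE_iff)
  ultimately show ?thesis by blast
qed

lemma min_half_density_attained:
  assumes "finite_simple_graph V E"
  obtains \<mu> where "is_half V \<mu>" "min_half_density V E = half_density V E \<mu>"
    "\<And>\<nu>. is_half V \<nu> \<Longrightarrow> min_half_density V E \<le> half_density V E \<nu>"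
proof -
  obtain \<mu> where \<mu>: "is_half V \<mu>" "\<And>\<nu>. is_half V \<nu> \<Longrightarrow> half_density V E \<mu> \<le> half_density V E \<nu>"
    using ex_minimal_half[OF assms] by blast
  have "min_half_density V E = half_density V E \<mu>"
    unfolding min_half_density_def by (rule Least_equality) (use \<mu> in auto)
  with \<mu> that show ?thesis by metis
qed

end

theory Submission
  imports Defs
begin

text \<open>
  Let \<open>A\<close> be a maximum independent set, \<open>k = card A\<close>, \<open>n = card V\<close> and \<open>M = n/2 - k\<close>; the claim
  is that some half has edge weight at most \<open>k M / 2\<close>. Write \<open>d v\<close> for the number of neighbours of \<open>v\<close> in
  \<open>A\<close>. Adjacent vertices have disjoint neighbourhoods, so the vertices with \<open>d v > k/2\<close> are
  independent and number at most \<open>k\<close>; hence the set \<open>S\<close> of vertices outside \<open>A\<close> with \<open>d v \<le> k/2\<close>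
  has at least \<open>2 M\<close> elements. If \<open>S\<close> contains an independent set of size at least \<open>M\<close>, spreading
  the missing mass \<open>M\<close> uniformly over it works. Otherwise all degrees inside \<open>S\<close> are below \<open>M\<close>, and
  for some \<open>a \<in> A\<close> it works to spread \<open>M\<close> uniformly over the non-neighbours of \<open>a\<close> in \<open>S\<close>:
  averaging over \<open>a\<close>, an edge \<open>u v\<close> inside \<open>S\<close> survives for only \<open>k - d u - d v\<close> of the \<open>k\<close>
  choices, and the resulting inequality holds term by term because \<open>M \<le> k/2\<close>.
\<close>

locale triangle_free_graph =
  fixes V :: "'a set" and E :: "'a set set"
  assumes graph: "finite_simple_graph V E"
    and triangle_free: "triangle_free V E"
begin

text \<open>A real-valued indicator, so that counting edges and neighbours becomes manipulation of
  finite sums.\<close>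

definition adj :: "'a \<Rightarrow> 'a \<Rightarrow> real" where
  "adj u v = of_bool ({u, v} \<in> E)"

definition deg :: "'a set \<Rightarrow> 'a \<Rightarrow> real" where
  "deg W v = (\<Sum>u\<in>W. adj u v)"

lemma finite_V [simp]: "finite V"
  using graph by (simp add: finite_simple_graph_def)

lemma finite_sub: "W \<subseteq> V \<Longrightarrow> finite W"
  using finite_subset finite_V by blast

lemma adj_commute: "adj u v = adj v u"
  by (simp add: adj_def insert_commute)

lemma adj_nonneg [simp]: "0 \<le> adj u v"
  by (simp add: adj_def)

lemma edge_distinct: "{u, v} \<in> E \<Longrightarrow> u \<noteq> v"
  using graph by (auto simp: finite_simple_graph_def nsets_def)

lemma adj_indep:
  assumes "indep A E" "u \<in> A" "v \<in> A"
  shows "adj u v = 0"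
  using assms edge_distinct by (auto simp: adj_def indep_def)

lemma no_triangle:
  assumes "{u, v} \<in> E" "{v, w} \<in> E" "{u, w} \<in> E"
  shows False
proof -
  have "{u, v, w} \<subseteq> V"
    using assms graph by (auto simp: finite_simple_graph_def nsets_def)
  moreover have "card {u, v, w} = 3"
    using assms edge_distinct by auto
  moreover have "clique {u, v, w} E"
    using assms by (auto simp: clique_def insert_commute)
  ultimately show False
    using triangle_free by (auto simp: triangle_free_def)
qed

text \<open>This removes the product term when \<open>(1 - adj u a) * (1 - adj v a)\<close> is
  expanded for an edge \<open>{u, v}\<close>.\<close>

lemma adj_triangle: "adj u v * (adj a u * adj a v) = 0"
  using no_triangle[of a u v] by (auto simp: adj_def)

lemma indep_neighbours: "indep {u \<in> W. {u, v} \<in> E} E"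
  using no_triangle by (auto simp: indep_def insert_commute)

lemma deg_card: "finite W \<Longrightarrow> deg W v = card {u \<in> W. {u, v} \<in> E}"
  by (simp add: deg_def adj_def of_bool_def sum.If_cases Int_def)

text \<open>No vertex of \<open>W\<close> can be adjacent to both ends of an edge.\<close>

lemma deg_add_le_card:
  assumes "finite W" "{u, v} \<in> E"
  shows "deg W u + deg W v \<le> card W"
proof -
  have "adj w u + adj w v \<le> 1" for w
    using no_triangle[of w u v] assms by (auto simp: adj_def)
  then have "(\<Sum>w\<in>W. adj w u + adj w v) \<le> (\<Sum>w\<in>W. 1)"
    by (intro sum_mono)
  then show ?thesis
    by (simp add: deg_def sum.distrib)
qed

text \<open>Each edge comes from exactly two ordered pairs of vertices, hence the factor 2.\<close>

lemma sum_edges: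
  "2 * (\<Sum>e\<in>E. \<Prod>w\<in>e. \<mu> w) = (\<Sum>u\<in>V. \<Sum>v\<in>V. adj u v * (\<mu> u * \<mu> v))"
proof -
  define P where "P = {p \<in> V \<times> V. {fst p, snd p} \<in> E}"
  have fin: "finite P" "finite E"
    using graph by (auto simp: P_def finite_simple_graph_def finite_imp_finite_nsets intro: finite_subset)
  have "(\<Sum>u\<in>V. \<Sum>v\<in>V. adj u v * (\<mu> u * \<mu> v)) =
      (\<Sum>p\<in>V \<times> V. if {fst p, snd p} \<in> E then \<mu> (fst p) * \<mu> (snd p) else 0)"
    unfolding sum.cartesian_product by (intro sum.cong) (auto simp: adj_def)
  also have "\<dots> = (\<Sum>p\<in>P. \<mu> (fst p) * \<mu> (snd p))"
    by (simp add: P_def sum.inter_filter)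
  also have "\<dots> = (\<Sum>e\<in>E. \<Sum>p | p \<in> P \<and> {fst p, snd p} = e. \<mu> (fst p) * \<mu> (snd p))"
    by (rule sum.group[symmetric]) (use fin in \<open>auto simp: P_def\<close>)
  also have "\<dots> = (\<Sum>e\<in>E. 2 * (\<Prod>w\<in>e. \<mu> w))"
  proof (rule sum.cong)
    fix e assume "e \<in> E"
    then obtain u v where uv: "e = {u, v}" "u \<noteq> v" "u \<in> V" "v \<in> V"
      using graph by (auto simp: finite_simple_graph_def nsets_def card_2_iff)
    then have "p \<in> P \<and> {fst p, snd p} = e \<longleftrightarrow> p = (u, v) \<or> p = (v, u)" for p
      using \<open>e \<in> E\<close> by (cases p) (auto simp: P_def doubleton_eq_iff insert_commute)
    then have "{p. p \<in> P \<and> {fst p, snd p} = e} = {(u, v), (v, u)}"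
      by auto
    then show "(\<Sum>p | p \<in> P \<and> {fst p, snd p} = e. \<mu> (fst p) * \<mu> (snd p)) = 2 * (\<Prod>w\<in>e. \<mu> w)"
      using uv by simp
  qed simp
  finally show ?thesis
    by (simp add: sum_distrib_left)
qed

text \<open>The test half is 1 on \<open>A\<close>, \<open>c\<close> on \<open>R\<close> and 0
  elsewhere. Edges between \<open>A\<close> and \<open>R\<close> weigh \<open>c\<close>; edges
  inside \<open>R\<close> weigh \<open>c * c\<close>, and the degree sum counts them from both
  ends.\<close>

lemma min_half_density_le:
  fixes c :: real
  assumes "A \<subseteq> V" "R \<subseteq> V" "A \<inter> R = {}" "indep A E"
    and c: "0 \<le> c" "c \<le> 1" "card A + c * card R = card V / 2"
  shows "min_half_density V E * (card V)\<^sup>2 \<le> c * (\<Sum>v\<in>R. deg A v) + c\<^sup>2 / 2 * (\<Sum>v\<in>R. deg R v)"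
proof -
  define \<mu> where "\<mu> v = of_bool (v \<in> A) + c * of_bool (v \<in> R)" for v
  have sum_\<mu>: "(\<Sum>v\<in>V. f v * \<mu> v) = (\<Sum>v\<in>A. f v) + c * (\<Sum>v\<in>R. f v)" for f :: "'a \<Rightarrow> real"
  proof -
    have "(\<Sum>v\<in>V. f v * of_bool (v \<in> W)) = (\<Sum>v\<in>W. f v)" if "W \<subseteq> V" for W
      using that by (intro sum.mono_neutral_cong_right) auto
    moreover have "(\<Sum>v\<in>V. f v * \<mu> v) = (\<Sum>v\<in>V. f v * of_bool (v \<in> A)) + c * (\<Sum>v\<in>V. f v * of_bool (v \<in> R))"
      unfolding \<mu>_def sum_distrib_left sum.distrib[symmetric]
      by (intro sum.cong) (auto simp: algebra_simps)
    ultimately show ?thesis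
      using assms(1,2) by simp
  qed
  have "is_half V \<mu>"
    unfolding is_half_def using sum_\<mu>[of "\<lambda>_. 1"] c assms(3) by (auto simp: \<mu>_def)
  then have "min_half_density V E \<le> half_density V E \<mu>"
    using min_half_density_attained[OF graph] by metis
  then have *: "min_half_density V E * (card V)\<^sup>2 \<le> (\<Sum>e\<in>E. \<Prod>w\<in>e. \<mu> w)" if "V \<noteq> {}"
    using that by (simp add: half_density_def pos_le_divide_eq card_gt_0_iff)
  have AA: "(\<Sum>v\<in>A. deg A v) = 0"
    using adj_indep[OF \<open>indep A E\<close>] by (simp add: deg_def)
  have RA: "(\<Sum>v\<in>A. deg R v) = (\<Sum>v\<in>R. deg A v)"
    unfolding deg_def by (subst sum.swap) (simp add: adj_commute)
  have "2 * (\<Sum>e\<in>E. \<Prod>w\<in>e. \<mu> w) = (\<Sum>u\<in>V. (\<Sum>v\<in>V. adj v u * \<mu> v) * \<mu> u)"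
    unfolding sum_edges sum_distrib_right
    by (intro sum.cong refl) (simp add: adj_commute mult_ac)
  also have "\<dots> = (\<Sum>u\<in>V. (deg A u + c * deg R u) * \<mu> u)"
    by (simp only: sum_\<mu> deg_def)
  also have "\<dots> = c * (\<Sum>v\<in>R. deg A v) + c * (\<Sum>v\<in>A. deg R v) + c * c * (\<Sum>v\<in>R. deg R v)"
    by (simp only: sum_\<mu> sum.distrib AA) (simp add: algebra_simps flip: sum_distrib_left)
  finally have "(\<Sum>e\<in>E. \<Prod>w\<in>e. \<mu> w) = c * (\<Sum>v\<in>R. deg A v) + c\<^sup>2 / 2 * (\<Sum>v\<in>R. deg R v)"
    by (simp add: RA power2_eq_square algebra_simps)
  with * show ?thesis
    using assms(1,2) by (cases "V = {}") auto
qed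

lemma min_half_density_le_indep_number:
  assumes "A \<subseteq> V" "indep A E"
    and max: "\<And>I. I \<subseteq> V \<Longrightarrow> indep I E \<Longrightarrow> card I \<le> card A"
    and bounds: "card V \<le> 3 * card A" "2 * card A \<le> card V"
  shows "min_half_density V E * (card V)\<^sup>2 \<le> card A / 2 * (card V / 2 - card A)"
proof -
  define k where "k = real (card A)"
  define M where "M = card V / 2 - k"
  define d where "d = deg A"
  define S where "S = {b \<in> V - A. 2 * d b \<le> k}"
  define L where "L = V - A - S"
  have S: "S \<subseteq> V" "A \<inter> S = {}" and fin: "finite A" "finite S"
    using \<open>A \<subseteq> V\<close> finite_sub by (auto simp: S_def)
  have M: "0 \<le> M" "M \<le> k / 2"
    using bounds by (auto simp: M_def k_def)
  have "indep L E"
    unfolding indep_def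
  proof (intro ballI impI notI)
    fix u v assume "u \<in> L" "v \<in> L" "{u, v} \<in> E"
    then have "d u + d v \<le> k" "2 * d u > k" "2 * d v > k"
      using deg_add_le_card[OF \<open>finite A\<close>] by (auto simp: L_def S_def d_def k_def)
    then show False by simp
  qed
  then have "card L \<le> card A"
    by (intro max) (auto simp: L_def)
  moreover have "card V = card A + card S + card L"
  proof -
    have "V = A \<union> (S \<union> L)" using \<open>A \<subseteq> V\<close> S by (auto simp: L_def)
    then have "card V = card (A \<union> (S \<union> L))" by simp
    also have "\<dots> = card A + (card S + card L)"
      using fin S finite_sub[of L] by (subst card_Un_disjoint; (subst card_Un_disjoint)?) (auto simp: L_def)
    finally show ?thesis by simp
  qed
  ultimately have card_S: "2 * M \<le> card S"
    by (simp add: M_def k_def field_simps)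
  have "min_half_density V E * (card V)\<^sup>2 \<le> k / 2 * M"
  proof (cases "\<exists>I\<subseteq>S. indep I E \<and> M \<le> card I")
    case True
    then obtain I where I: "I \<subseteq> S" "indep I E" "M \<le> card I" by blast
    \<comment> \<open>If \<open>I\<close> is empty, then \<open>M = 0\<close> and division by zero
      gives \<open>c = 0\<close>, the correct value.\<close>
    define c where "c = M / card I"
    have c: "c * card I = M" "0 \<le> c" "c \<le> 1"
      using M I by (auto simp: c_def divide_le_eq)
    have "(\<Sum>v\<in>I. deg I v) = 0"
      using adj_indep[OF \<open>indep I E\<close>] by (simp add: deg_def)
    then have "min_half_density V E * (card V)\<^sup>2 \<le> c * (\<Sum>v\<in>I. d v)"
      using min_half_density_le[of A I c] I S assms c by (auto simp: M_def k_def d_def)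
    also have "\<dots> \<le> c * (\<Sum>v\<in>I. k / 2)"
      using I by (intro mult_left_mono sum_mono c) (auto simp: S_def)
    also have "\<dots> = k / 2 * M"
      by (simp flip: c(1))
    finally show ?thesis .
  next
    case False
    then have small: "card I < M" if "I \<subseteq> S" "indep I E" for I
      using that by force
    \<comment> \<open>The neighbours of \<open>v\<close> in \<open>S\<close> form an independent
      set.\<close>
    have deg_S: "deg S v < M" for v
      using small[OF _ indep_neighbours] fin by (auto simp: deg_card)
    define R where "R a = S - {b \<in> S. {b, a} \<in> E}" for a
    show ?thesis
    proof (rule ccontr)
      assume contr: "\<not> ?thesis"
      \<comment> \<open>The half that is 1 on \<open>A\<close> and \<open>c\<close> on
        \<open>R a\<close> exceeds \<open>k / 2 * M\<close>, too. Estimating \<open>c * c\<close> by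
        \<open>c\<close> and cancelling one factor \<open>c\<close> leaves a bound free of
        \<open>c\<close>, which can be summed over \<open>a\<close>.\<close>
      have R_bound: "k / 2 * card (R a) < (\<Sum>v\<in>R a. d v) + (\<Sum>v\<in>R a. deg (R a) v) / 2" for a
      proof -
        define c where "c = M / card (R a)"
        \<comment> \<open>Of the at least \<open>2 * M\<close> vertices of \<open>S\<close>, fewer
          than \<open>M\<close> are adjacent to \<open>a\<close>.\<close>
        have "M < card (R a)"
        proof -
          have "real (card (R a)) = card S - deg S a"
            using fin by (simp add: R_def deg_card card_Diff_subset of_nat_diff card_mono)
          with deg_S[of a] card_S show ?thesis by simp
        qed
        \<comment> \<open>The empty set is independent but does not qualify for the first
          case.\<close>
        moreover have "0 < M"
          using small[of "{}"] by (simp add: indep_def)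
        ultimately have c: "c * card (R a) = M" "0 < c" "c \<le> 1"
          by (auto simp: c_def divide_le_eq)
        have "R a \<subseteq> S" by (auto simp: R_def)
        then have "min_half_density V E * (card V)\<^sup>2
            \<le> c * (\<Sum>v\<in>R a. d v) + c\<^sup>2 / 2 * (\<Sum>v\<in>R a. deg (R a) v)"
          using min_half_density_le[of A "R a" c] S assms c by (auto simp: M_def k_def d_def)
        also have "\<dots> \<le> c * (\<Sum>v\<in>R a. d v) + c / 2 * (\<Sum>v\<in>R a. deg (R a) v)"
          using c by (intro add_left_mono mult_right_mono)
            (auto simp: power2_eq_square mult_le_cancel_left1 deg_def sum_nonneg)
        finally have "c * (k / 2 * card (R a)) < c * ((\<Sum>v\<in>R a. d v) + (\<Sum>v\<in>R a. deg (R a) v) / 2)"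
          using contr by (simp add: algebra_simps flip: c(1))
        with \<open>0 < c\<close> show ?thesis by simp
      qed
      \<comment> \<open>Indicator of non-adjacency: it turns sums over the varying sets
        \<open>R a\<close> into sums over the fixed set \<open>S\<close>, so that the sum over
        \<open>a\<close> can be moved inside.\<close>
      define n where "n b a = 1 - adj b a" for a b
      have sum_R: "(\<Sum>v\<in>R a. f v) = (\<Sum>v\<in>S. n v a * f v)" for a and f :: "'a \<Rightarrow> real"
        using fin by (intro sum.mono_neutral_cong_left) (auto simp: R_def n_def adj_def)
      have sum_n: "(\<Sum>a\<in>A. n b a) = k - d b" for b
        by (simp add: n_def d_def deg_def k_def sum_subtractf adj_commute)
      have 1: "(\<Sum>a\<in>A. \<Sum>v\<in>R a. f v) = (\<Sum>v\<in>S. (k - d v) * f v)" for f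
        unfolding sum_R by (subst sum.swap) (simp flip: sum_distrib_right add: sum_n)
      have adj_n: "adj u v * (\<Sum>a\<in>A. n u a * n v a) = adj u v * (k - d u - d v)" for u v
      proof -
        have "adj u v * (n u a * n v a) = adj u v * (1 - adj a u - adj a v)" for a
          using adj_triangle[of u v a] by (simp add: n_def algebra_simps adj_commute)
        then have "(\<Sum>a\<in>A. adj u v * (n u a * n v a)) = (\<Sum>a\<in>A. adj u v * (1 - adj a u - adj a v))"
          by (simp only:)
        then have "adj u v * (\<Sum>a\<in>A. n u a * n v a) = adj u v * (\<Sum>a\<in>A. 1 - adj a u - adj a v)"
          by (simp only: sum_distrib_left)
        then show ?thesis
          by (simp add: sum_subtractf d_def deg_def k_def)
      qed
      have "(\<Sum>a\<in>A. \<Sum>v\<in>R a. deg (R a) v) = (\<Sum>a\<in>A. \<Sum>v\<in>S. \<Sum>u\<in>S. adj u v * (n u a * n v a))"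
        unfolding deg_def sum_R sum_distrib_left by (simp only: mult_ac)
      also have "\<dots> = (\<Sum>v\<in>S. \<Sum>a\<in>A. \<Sum>u\<in>S. adj u v * (n u a * n v a))"
        by (rule sum.swap)
      also have "\<dots> = (\<Sum>v\<in>S. \<Sum>u\<in>S. adj u v * (\<Sum>a\<in>A. n u a * n v a))"
        unfolding sum_distrib_left by (intro sum.cong refl sum.swap)
      \<comment> \<open>Splitting \<open>k - d u - d v\<close> evenly gives two sums that agree by
        symmetry; on \<open>S\<close> the weights \<open>k / 2 - d v\<close> are nonnegative, so
        \<open>deg S v\<close> may then be replaced by \<open>M\<close>.\<close>
      also have "\<dots> = (\<Sum>v\<in>S. \<Sum>u\<in>S. adj u v * (k / 2 - d u)) + (\<Sum>v\<in>S. \<Sum>u\<in>S. adj u v * (k / 2 - d v))"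
        unfolding adj_n sum.distrib[symmetric] by (intro sum.cong refl) (simp add: algebra_simps)
      also have "(\<Sum>v\<in>S. \<Sum>u\<in>S. adj u v * (k / 2 - d u)) = (\<Sum>v\<in>S. \<Sum>u\<in>S. adj u v * (k / 2 - d v))"
        by (subst sum.swap) (simp add: adj_commute)
      also have "(\<Sum>v\<in>S. \<Sum>u\<in>S. adj u v * (k / 2 - d v)) = (\<Sum>v\<in>S. deg S v * (k / 2 - d v))"
        by (simp add: deg_def sum_distrib_right)
      also have "\<dots> \<le> (\<Sum>v\<in>S. M * (k / 2 - d v))"
        using deg_S by (intro sum_mono mult_right_mono) (auto simp: S_def less_imp_le)
      finally have 2: "(\<Sum>a\<in>A. \<Sum>v\<in>R a. deg (R a) v) / 2 \<le> (\<Sum>v\<in>S. M * (k / 2 - d v))"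
        by simp
      have "A \<noteq> {}"
        using M small[of "{}"] by (auto simp: k_def indep_def)
      then have "(\<Sum>a\<in>A. k / 2 * card (R a))
          < (\<Sum>a\<in>A. (\<Sum>v\<in>R a. d v) + (\<Sum>v\<in>R a. deg (R a) v) / 2)"
        using fin R_bound by (intro sum_strict_mono) auto
      also have "\<dots> \<le> (\<Sum>v\<in>S. (k - d v) * d v + M * (k / 2 - d v))"
        using 1[of d] 2 by (simp add: sum.distrib flip: sum_divide_distrib)
      also have "\<dots> \<le> (\<Sum>v\<in>S. (k - d v) * (k / 2))"
      proof (intro sum_mono)
        fix v assume "v \<in> S"
        \<comment> \<open>This product is the difference of the two sides; its second factor is
          nonnegative since \<open>d v\<close> and \<open>M\<close> are both at most
          \<open>k / 2\<close>.\<close>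
        then have "0 \<le> (k / 2 - d v) * (k - d v - M)"
          using M by (intro mult_nonneg_nonneg) (auto simp: S_def)
        then show "(k - d v) * d v + M * (k / 2 - d v) \<le> (k - d v) * (k / 2)"
          by (simp add: field_simps)
      qed
      \<comment> \<open>Each \<open>v\<close> in \<open>S\<close> lies in \<open>R a\<close> for
        exactly \<open>k - d v\<close> of the \<open>a\<close> in \<open>A\<close>.\<close>
      also have "\<dots> = (\<Sum>a\<in>A. k / 2 * card (R a))"
        using 1[of "\<lambda>_. k / 2"] by (simp add: mult.commute)
      finally show False by simp
    qed
  qed
  then show ?thesis by (simp add: M_def k_def)
qed

end

theorem theorem3p6:
  fixes V :: "'a set" and E :: "'a set set"
  assumes "finite_simple_graph V E"
    and "V \<noteq> {}"
    and "triangle_free V E"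
    and "3/8 \<le> rel_indep_number V E"
    and "rel_indep_number V E \<le> 1/2"
  shows "min_half_density V E \<le> 1/2 * rel_indep_number V E * (1/2 - rel_indep_number V E)"
proof -
  interpret triangle_free_graph V E
    using assms by unfold_locales
  define X where "X = {real (card A) / real (card V) | A. A \<subseteq> V \<and> indep A E}"
  have "X = (\<lambda>A. real (card A) / real (card V)) ` {A. A \<subseteq> V \<and> indep A E}"
    by (auto simp: X_def)
  then have "finite X" by simp
  moreover have "X \<noteq> {}"
    by (auto simp: X_def indep_def intro!: exI[of _ "{}"])
  ultimately have "Max X \<in> X" and X_le: "\<And>x. x \<in> X \<Longrightarrow> x \<le> Max X"
    by auto
  have \<alpha>: "rel_indep_number V E = Max X"
    by (simp add: rel_indep_number_def X_def)
  have n: "0 < real (card V)"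
    using \<open>V \<noteq> {}\<close> by (simp add: card_gt_0_iff)
  obtain A where A: "A \<subseteq> V" "indep A E" "Max X = card A / card V"
    using \<open>Max X \<in> X\<close> by (auto simp: X_def)
  have "card I \<le> card A" if "I \<subseteq> V" "indep I E" for I
  proof -
    have "card I / card V \<in> X"
      using that by (auto simp: X_def)
    then show ?thesis
      using X_le[of "card I / card V"] n A(3) by (simp add: divide_le_cancel)
  qed
  \<comment> \<open>As 8/3 < 3, the first inequality yields \<open>card V \<le> 3 * card A\<close>,
    that is, a missing mass of at most \<open>card A / 2\<close>.\<close>
  moreover have "3 * real (card V) \<le> 8 * real (card A)" "2 * real (card A) \<le> real (card V)"
    using assms(4,5) n by (simp_all add: \<alpha> A(3) field_simps)
  ultimately have "min_half_density V E * (card V)\<^sup>2 \<le> card A / 2 * (card V / 2 - card A)"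
    using A by (intro min_half_density_le_indep_number) auto
  then have "min_half_density V E \<le> card A / 2 * (card V / 2 - card A) / (card V)\<^sup>2"
    using \<open>V \<noteq> {}\<close> by (subst pos_le_divide_eq) simp_all
  also have "\<dots> = 1/2 * Max X * (1/2 - Max X)"
    using \<open>V \<noteq> {}\<close> unfolding A(3) by (simp add: field_simps power2_eq_square)
  finally show ?thesis
    by (simp add: \<alpha>)
qed

end
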